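(* Let $S_n=(S_n^x,S_n^y)$, $n\ge 0$, be the simple random walk on the 2-dimensional comb $\mathbf C_2$ started at $S_0=(0,0)$. Then $$\mathbb E[|S_n^x|]\sim\frac{1}{2^{3/4}\,\Gamma(5/4)}\,n^{1/4}\qquad (n\to\infty).$$
   Context: The 2-dimensional comb $\mathbf C_2$ is the graph with vertex set $\mathbb Z^2$ obtained from the usual square lattice by removing all horizontal edges off the $x$-axis: $(x,y)$ is adjacent to $(x,y\pm1)$ for all $x,y\in\mathbb Z$, and $(x,0)$ is adjacent to $(x\pm1,0)$ for all $x\in\mathbb Z$. The simple random walk moves at each step to a uniformly chosen neighbour of the current vertex (transition probabilities $1/4$ from vertices on the $x$-axis and $1/2$ from other vertices). $a_n\sim b_n$ means $a_n/b_n\to1$, and $\Gamma$ is the Euler gamma function. *)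

theory Defs
  imports "HOL-Probability.Probability" "HOL-Library.Landau_Symbols"
begin

fun comb_adj :: "int \<times> int \<Rightarrow> int \<times> int \<Rightarrow> bool" where
  "comb_adj (x, y) (x', y') \<longleftrightarrow>
     x' = x \<and> (y' = y + 1 \<or> y' = y - 1) \<or>
     y = 0 \<and> y' = 0 \<and> (x' = x + 1 \<or> x' = x - 1)"

text \<open>
  The transition law from \<open>u\<close> is \<open>pmf_of_set {w. adj u w}\<close>, which is the uniform distribution only if
  \<open>u\<close> has finitely many neighbours and at least one. For the comb this is guaranteed by the lemmas
  below. The condition \<open>step\<close> is the Markov property with these transition probabilities, conditioning
  on the whole past; as usual it is only required for histories of positive probability.
\<close>

locale simple_random_walk = prob_space M
  for M :: "'w measure" +
  fixes adj :: "'v \<Rightarrow> 'v \<Rightarrow> bool"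
    and v0 :: 'v
    and S :: "nat \<Rightarrow> 'w \<Rightarrow> 'v"
  assumes random_variable: "\<And>n. S n \<in> measurable M (count_space UNIV)"
    and start: "AE \<omega> in M. S 0 \<omega> = v0"
    and step: "\<And>n v w. \<P>(\<omega> in M. \<forall>i\<le>n. S i \<omega> = v i) > 0 \<Longrightarrow>
      \<P>(\<omega> in M. S (Suc n) \<omega> = w \<bar> \<forall>i\<le>n. S i \<omega> = v i) = pmf (pmf_of_set {u. adj (v n) u}) w"

lemma comb_adj_sym: "comb_adj u v \<longleftrightarrow> comb_adj v u"
  by (cases u; cases v) auto

lemma comb_neighbours_axis:
  "{u. comb_adj (x, 0) u} = {(x, 1), (x, -1), (x + 1, 0), (x - 1, 0)}"
  by auto

lemma comb_neighbours_off_axis: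
  "y \<noteq> 0 \<Longrightarrow> {u. comb_adj (x, y) u} = {(x, y + 1), (x, y - 1)}"
  by auto

lemma pmf_comb_axis:
  "pmf (pmf_of_set {u. comb_adj (x, 0) u}) w = (if comb_adj (x, 0) w then 1 / 4 else 0)"
proof -
  have "pmf (pmf_of_set {u. comb_adj (x, 0) u}) w = indicator {u. comb_adj (x, 0) u} w / 4"
    by (subst pmf_of_set) (simp_all add: comb_neighbours_axis)
  then show ?thesis by (simp only: indicator_def mem_Collect_eq) simp
qed

lemma pmf_comb_off_axis:
  assumes "y \<noteq> 0"
  shows "pmf (pmf_of_set {u. comb_adj (x, y) u}) w = (if comb_adj (x, y) w then 1 / 2 else 0)"
proof -
  have "pmf (pmf_of_set {u. comb_adj (x, y) u}) w = indicator {u. comb_adj (x, y) u} w / 2"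
    by (subst pmf_of_set) (simp_all add: comb_neighbours_off_axis[OF assms])
  then show ?thesis by (simp only: indicator_def mem_Collect_eq) simp
qed

end

theory Submission
  imports Defs "HOL-Analysis.Generalised_Binomial_Theorem"
begin

text \<open>
  On the axis the first coordinate makes a symmetric step with probability \<open>1 / 2\<close>, off the axis it
  stands still. Hence the expectation of \<open>\<bar>x\<bar>\<close> increases exactly when the walk is at the origin, and
  then by \<open>1 / 2\<close> (\<open>expectation_comb_Suc\<close>): the claim is one about the expected number of visits to
  the origin.

  The generating functions of the probabilities of being at \<open>(x, y)\<close> solve the forward equations of
  the walk, and formal power series solutions of these are unique. A solution has the form of a
  constant times \<open>r\<^bsup>\<bar>x\<bar>\<^esup> f\<^bsup>\<bar>y\<bar>\<^esup>\<close>, with an extra factor \<open>1 / 2\<close> off the axis, where \<open>f\<close> and \<open>r\<close> solve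
  quadratic equations. The nested radicals simplify completely in terms of \<open>a = (1 + X)\<^sup>1\<^sup>/\<^sup>4\<close> and
  \<open>b = (1 - X)\<^sup>1\<^sup>/\<^sup>4\<close>: the solution is \<open>f = (a\<^sup>2 - b\<^sup>2) / (a\<^sup>2 + b\<^sup>2)\<close>, \<open>r = (a - b) / (a + b)\<close>, with value
  \<open>2 / (a * b * (a\<^sup>2 + b\<^sup>2))\<close> at the origin (\<open>comb_green_nth\<close>). Summing over time, the expected
  displacement has the generating function \<open>(a * b\<^sup>-\<^sup>5 - a\<^sup>-\<^sup>1 * b\<^sup>-\<^sup>3) / 2\<close> (\<open>expectation_comb_explicit\<close>).

  The asymptotics can be read off this closed form. The coefficients of \<open>a\<^sup>-\<^sup>1 * b\<^sup>-\<^sup>3\<close> are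
  bounded by one (\<open>binomial_convolution_bound\<close>). Those of \<open>b\<^sup>-\<^sup>5 = (1 - X)\<^sup>-\<^sup>5\<^sup>/\<^sup>4\<close> are increasing and
  asymptotic to \<open>n\<^sup>1\<^sup>/\<^sup>4 / \<Gamma>(5/4)\<close>, those of \<open>a\<close> are absolutely summable with sum \<open>2\<^sup>1\<^sup>/\<^sup>4\<close>, so those
  of the product are asymptotic to \<open>2\<^sup>1\<^sup>/\<^sup>4 * n\<^sup>1\<^sup>/\<^sup>4 / \<Gamma>(5/4)\<close> (\<open>binomial_convolution_asymptotic\<close>). Half
  of this is the claim, as \<open>2\<^sup>1\<^sup>/\<^sup>4 / 2 = 1 / 2\<^sup>3\<^sup>/\<^sup>4\<close>.
\<close>

unbundle no vec_syntax and fps_syntax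

section \<open>The marginal laws of a random walk\<close>

primrec walk_law :: "('v \<Rightarrow> 'v \<Rightarrow> bool) \<Rightarrow> 'v \<Rightarrow> nat \<Rightarrow> 'v pmf" where
  "walk_law adj v 0 = return_pmf v"
| "walk_law adj v (Suc n) = bind_pmf (walk_law adj v n) (\<lambda>u. pmf_of_set {w. adj u w})"

text \<open>
  The Markov property conditions on the whole past, so the one-step recursion for the laws is obtained
  by splitting over all histories. Recording a history as a list makes the set of histories countable
  whenever the state space is.
\<close>

context simple_random_walk
begin

definition history :: "nat \<Rightarrow> 'w \<Rightarrow> 'v list" where
  "history n \<omega> = map (\<lambda>i. S i \<omega>) [0..<Suc n]"

end

lemma (in simple_random_walk) history_eq_iff:
  "history n \<omega> = h \<longleftrightarrow> length h = Suc n \<and> (\<forall>i\<le>n. S i \<omega> = h ! i)"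
  by (auto simp: history_def list_eq_iff_nth_eq less_Suc_eq_le simp del: upt_Suc)

text \<open>
  The statement is about laws only, so the underlying probability space can be replaced by the
  probability mass functions \<open>walk_law\<close>. In the induction step two measures on histories are
  compared: the law of the history restricted to the event that the next state is \<open>w\<close>, and the law
  of the history weighted with the transition probability to \<open>w\<close>. By the Markov property they agree
  on each single history, hence have the same total mass, and that mass is the recursion.
\<close>

lemma distr_walk:
  fixes S :: "nat \<Rightarrow> 'w \<Rightarrow> 'v :: countable"
  assumes "simple_random_walk M adj v0 S"
  shows "distr M (count_space UNIV) (S n) = measure_pmf (walk_law adj v0 n)"
proof -
  interpret simple_random_walk M adj v0 S by fact
  note [measurable] = random_variable
  show ?thesis
  proof (induction n)
    case 0
    have "distr M (count_space UNIV) (S 0) = distr M (count_space UNIV) (\<lambda>_. v0)"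
      using start by (intro distr_cong_AE) auto
    also have "\<dots> = return (count_space UNIV) v0"
      by (rule distr_const) auto
    finally show ?case by (simp add: return_pmf.rep_eq)
  next
    case (Suc n)
    define K where "K u w = pmf (pmf_of_set {w. adj u w}) w" for u w
    have hist [measurable]: "history n \<in> measurable M (count_space UNIV)"
    proof (subst measurable_count_space_eq2_countable, safe)
      fix h :: "'v list"
      have "history n -` {h} \<inter> space M = {\<omega> \<in> space M. length h = Suc n \<and> (\<forall>i\<le>n. S i \<omega> = h ! i)}"
        using history_eq_iff[of n _ h] by blast
      also have "\<dots> \<in> sets M" by measurable
      finally show "history n -` {h} \<inter> space M \<in> sets M" .
    qed auto
    have "emeasure M {\<omega> \<in> space M. S (Suc n) \<omega> = w} = (\<integral>\<^sup>+ \<omega>. ennreal (K (S n \<omega>) w) \<partial>M)" for w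
    proof -
      let ?E = "{\<omega> \<in> space M. S (Suc n) \<omega> = w}"
      have E [measurable]: "?E \<in> sets M" by measurable
      have "distr (density M (indicator ?E)) (count_space UNIV) (history n)
          = distr (density M (\<lambda>\<omega>. ennreal (K (S n \<omega>) w))) (count_space UNIV) (history n)"
      proof (rule measure_eqI_countable[where A = UNIV])
        fix h
        let ?H = "{\<omega> \<in> space M. history n \<omega> = h}"
        have H [measurable]: "?H \<in> sets M" by measurable
        have vim: "history n -` {h} \<inter> space M = ?H" by auto
        have "emeasure M (?E \<inter> ?H) = ennreal (K (h ! n) w) * emeasure M ?H"
        \<comment> \<open>The Markov property is only available for histories of positive probability; the others contribute zero on both sides.\<close>
        proof (cases "measure M ?H > 0")
          case True
          then have len: "length h = Suc n"
            by (metis (mono_tags, lifting) Collect_empty_eq history_eq_iff less_irrefl measure_empty)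
          then have Heq: "?H = {\<omega> \<in> space M. \<forall>i\<le>n. S i \<omega> = h ! i}"
            by (auto simp: history_eq_iff)
          have "\<P>(\<omega> in M. S (Suc n) \<omega> = w \<bar> \<forall>i\<le>n. S i \<omega> = h ! i) = K (h ! n) w"
            using True unfolding Heq K_def by (rule step)
          moreover have "{\<omega> \<in> space M. S (Suc n) \<omega> = w \<and> (\<forall>i\<le>n. S i \<omega> = h ! i)} = ?E \<inter> ?H"
            using Heq by auto
          ultimately have "measure M (?E \<inter> ?H) = K (h ! n) w * measure M ?H"
            using True unfolding cond_prob_def Heq[symmetric] by (simp add: field_simps)
          then show ?thesis
            by (simp add: emeasure_eq_measure ennreal_mult K_def)
        next
          case False
          then have 0: "emeasure M ?H = 0"
            by (simp add: emeasure_eq_measure zero_less_measure_iff)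
          have "emeasure M (?E \<inter> ?H) \<le> emeasure M ?H"
            by (intro emeasure_mono) auto
          with 0 show ?thesis by simp
        qed
        also have "\<dots> = (\<integral>\<^sup>+ \<omega>. ennreal (K (h ! n) w) * indicator ?H \<omega> \<partial>M)"
          by (simp add: nn_integral_cmult_indicator)
        also have "\<dots> = (\<integral>\<^sup>+ \<omega>. ennreal (K (S n \<omega>) w) * indicator ?H \<omega> \<partial>M)"
          by (intro nn_integral_cong) (auto simp: history_eq_iff split: split_indicator)
        finally have "emeasure M (?E \<inter> ?H)
            = (\<integral>\<^sup>+ \<omega>. ennreal (K (S n \<omega>) w) * indicator ?H \<omega> \<partial>M)" .
        moreover have "emeasure M (?E \<inter> ?H) = (\<integral>\<^sup>+ \<omega>. indicator ?E \<omega> * indicator ?H \<omega> \<partial>M)"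
          unfolding indicator_inter_arith[symmetric]
          by (rule nn_integral_indicator[symmetric]) (rule sets.Int[OF E H])
        ultimately show "emeasure (distr (density M (indicator ?E)) (count_space UNIV) (history n)) {h} =
          emeasure (distr (density M (\<lambda>\<omega>. ennreal (K (S n \<omega>) w))) (count_space UNIV) (history n)) {h}"
          by (simp add: emeasure_distr emeasure_density vim)
      qed auto
      then have "emeasure (distr (density M (indicator ?E)) (count_space UNIV) (history n)) UNIV
          = emeasure (distr (density M (\<lambda>\<omega>. ennreal (K (S n \<omega>) w))) (count_space UNIV) (history n)) UNIV"
        by simp
      then show ?thesis
        by (simp add: emeasure_distr emeasure_density nn_integral_set_ennreal[symmetric] cong: nn_integral_cong)
    qed
    moreover have "(\<integral>\<^sup>+ \<omega>. ennreal (K (S n \<omega>) w) \<partial>M)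
        = (\<integral>\<^sup>+ u. ennreal (K u w) \<partial>distr M (count_space UNIV) (S n))" for w
      by (subst nn_integral_distr) auto
    ultimately have "emeasure M {\<omega> \<in> space M. S (Suc n) \<omega> = w} = pmf (walk_law adj v0 (Suc n)) w" for w
      unfolding Suc by (simp add: K_def ennreal_pmf_bind)
    then show ?case
      by (intro measure_eqI_countable[where A = UNIV])
        (auto simp: emeasure_distr emeasure_pmf_single vimage_def Int_def conj_commute)
  qed
qed

section \<open>Laws and expected displacement of the walk on the comb\<close>

lemma pmf_comb:
  "pmf (pmf_of_set {u. comb_adj v u}) w =
    (if comb_adj v w then if snd v = 0 then 1 / 4 else 1 / 2 else 0)"
  by (cases v; cases "snd v = 0") (simp_all add: pmf_comb_axis pmf_comb_off_axis)

lemma finite_comb_neighbours: "finite {u. comb_adj v u}"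
  by (cases v; cases "snd v = 0") (simp_all add: comb_neighbours_axis comb_neighbours_off_axis)

lemma comb_neighbours_nonempty: "{u. comb_adj v u} \<noteq> {}"
  by (cases v; cases "snd v = 0") (simp_all add: comb_neighbours_axis comb_neighbours_off_axis)

lemma set_pmf_comb: "set_pmf (pmf_of_set {u. comb_adj v u}) = {u. comb_adj v u}"
  by (rule set_pmf_of_set[OF comb_neighbours_nonempty finite_comb_neighbours])

abbreviation comb_law :: "nat \<Rightarrow> (int \<times> int) pmf" where
  "comb_law \<equiv> walk_law comb_adj (0, 0)"

lemma finite_comb_law: "finite (set_pmf (comb_law n))"
  by (induction n) (simp_all add: set_pmf_comb finite_comb_neighbours)

text \<open>
  The comb is symmetric, so the possible predecessors of \<open>w\<close> are its neighbours; the transition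
  probability depends on the predecessor only through whether it lies on the axis.
\<close>

lemma comb_law_forward:
  "pmf (comb_law (Suc n)) w =
    (\<Sum>v | comb_adj w v. pmf (comb_law n) v * (if snd v = 0 then 1 / 4 else 1 / 2))"
proof -
  have "pmf (comb_law (Suc n)) w =
      (\<integral>v. (if comb_adj v w then if snd v = 0 then 1 / 4 else 1 / 2 else 0) \<partial>comb_law n)"
    by (simp add: pmf_bind pmf_comb)
  also have "\<dots> = (\<Sum>v | comb_adj w v. pmf (comb_law n) v *\<^sub>R
      (if comb_adj v w then if snd v = 0 then 1 / 4 else 1 / 2 else 0))"
    by (rule integral_measure_pmf)
      (auto simp: finite_comb_neighbours split: if_splits intro: comb_adj_sym[THEN iffD1])
  also have "\<dots> = (\<Sum>v | comb_adj w v. pmf (comb_law n) v * (if snd v = 0 then 1 / 4 else 1 / 2))"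
    by (rule sum.cong) (use comb_adj_sym[of w] in auto)
  finally show ?thesis .
qed

text \<open>
  The function \<open>\<bar>x\<bar>\<close> is harmonic except at the origin: off the axis the first coordinate does not
  move, on the axis \<open>\<bar>x\<bar>\<close> is averaged over \<open>x \<plusminus> 1\<close>, and at the origin it grows by one with
  probability \<open>1 / 2\<close>. Hence the expected displacement grows only through visits to the origin.
\<close>

lemma expectation_comb_step:
  "measure_pmf.expectation (pmf_of_set {u. comb_adj v u}) (\<lambda>u. \<bar>real_of_int (fst u)\<bar>)
    = \<bar>real_of_int (fst v)\<bar> + (if v = (0, 0) then 1 / 2 else 0)"
proof (cases v)
  case (Pair x y)
  show ?thesis
  proof (cases "y = 0")
    case True
    then show ?thesis
      unfolding Pair True
      by (subst integral_pmf_of_set) (auto simp: comb_neighbours_axis abs_if)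
  next
    case False
    then show ?thesis
      unfolding Pair
      by (subst integral_pmf_of_set) (auto simp: comb_neighbours_off_axis)
  qed
qed

lemma expectation_comb_Suc:
  "measure_pmf.expectation (comb_law (Suc n)) (\<lambda>u. \<bar>real_of_int (fst u)\<bar>)
    = measure_pmf.expectation (comb_law n) (\<lambda>u. \<bar>real_of_int (fst u)\<bar>)
      + pmf (comb_law n) (0, 0) / 2"
proof -
  \<comment> \<open>The origin need not be in the support (parity), but has to be an index of the sum.\<close>
  let ?A = "insert (0, 0) (set_pmf (comb_law n))"
  have fin: "finite ?A" by (simp add: finite_comb_law)
  have "measure_pmf.expectation (comb_law (Suc n)) (\<lambda>u. \<bar>real_of_int (fst u)\<bar>)
      = (\<Sum>v\<in>?A. pmf (comb_law n) v *\<^sub>R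
          (\<bar>real_of_int (fst v)\<bar> + (if v = (0, 0) then 1 / 2 else 0)))"
    unfolding walk_law.simps expectation_comb_step[symmetric]
    using fin by (intro pmf_expectation_bind)
      (auto simp: set_pmf_comb finite_comb_neighbours)
  also have "\<dots> = (\<Sum>v\<in>?A. pmf (comb_law n) v *\<^sub>R \<bar>real_of_int (fst v)\<bar>)
      + (\<Sum>v\<in>?A. if v = (0, 0) then pmf (comb_law n) v / 2 else 0)"
    by (simp only: flip: sum.distrib) (intro sum.cong, auto simp: algebra_simps)
  also have "(\<Sum>v\<in>?A. if v = (0, 0) then pmf (comb_law n) v / 2 else 0) = pmf (comb_law n) (0, 0) / 2"
    using fin by (subst sum.delta) auto
  also have "(\<Sum>v\<in>?A. pmf (comb_law n) v *\<^sub>R \<bar>real_of_int (fst v)\<bar>)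
      = measure_pmf.expectation (comb_law n) (\<lambda>u. \<bar>real_of_int (fst u)\<bar>)"
    using fin by (intro integral_measure_pmf[symmetric]) auto
  finally show ?thesis .
qed

section \<open>Identities between fourth roots\<close>

text \<open>
  For \<open>a = (1 + x)\<^sup>1\<^sup>/\<^sup>4\<close> and \<open>b = (1 - x)\<^sup>1\<^sup>/\<^sup>4\<close> the nested square roots that solve the quadratic
  equations for \<open>f\<close> and \<open>r\<close> become rational: \<open>f = (a\<^sup>2 - b\<^sup>2) / (a\<^sup>2 + b\<^sup>2)\<close> and
  \<open>r = (a - b) / (a + b)\<close>. Here \<open>d\<close>, \<open>e\<close>, \<open>i\<close> are the inverses of the denominators, as power
  series have inverses of units only. The first three equations are those of a vertical excursion,
  of the decay along the axis, and of the balance at the origin. Everything reduces to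
  \<open>2 * x = (a\<^sup>2 - b\<^sup>2) * (a\<^sup>2 + b\<^sup>2)\<close> and
  \<open>(a\<^sup>2 + b\<^sup>2)\<^sup>2 + (a\<^sup>2 - b\<^sup>2)\<^sup>2 = 4\<close>.
\<close>

lemma fourth_roots_ring_identities:
  fixes a b d e i x :: "'a :: idom"
  assumes "a ^ 4 = 1 + x" "b ^ 4 = 1 - x"
    and d: "d * (a + b) = 1" and e: "e * (a\<^sup>2 + b\<^sup>2) = 1" and i: "i * (a * b) = 1"
    and nz: "(2 :: 'a) \<noteq> 0"
  defines "r \<equiv> (a - b) * d" and "f \<equiv> (a\<^sup>2 - b\<^sup>2) * e" and "g \<equiv> 2 * (i * e)"
  shows "2 * f = x * (1 + f\<^sup>2)"
    and "4 * r = x * (1 + r\<^sup>2) + 2 * x * f * r"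
    and "4 * g = 4 + 2 * x * f * g + 2 * x * g * r"
    and "x * g = (a\<^sup>2 - b\<^sup>2) * i"
proof -
  define p q where "p = a\<^sup>2 + b\<^sup>2" and "q = a\<^sup>2 - b\<^sup>2"
  have x: "2 * x = q * p" and one: "p\<^sup>2 + q\<^sup>2 = 4"
    using assms(1,2) unfolding p_def q_def by algebra+
  have ep: "e * p = 1" and f: "f = q * e"
    using e by (simp_all add: p_def q_def f_def)
  have xe: "2 * x * e = q"
    using x ep by algebra
  have xg: "x * g = q * i"
    unfolding g_def xe[symmetric] by (simp add: mult_ac)
  then show "x * g = (a\<^sup>2 - b\<^sup>2) * i"
    by (simp add: q_def)
  have "2 * x * (1 + f\<^sup>2) = q * e * (p\<^sup>2 + q\<^sup>2)"
    using x ep unfolding f by algebra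
  then have "2 * (2 * f) = 2 * (x * (1 + f\<^sup>2))"
    unfolding one f by (simp add: mult_ac)
  then show "2 * f = x * (1 + f\<^sup>2)"
    using nz by (simp only: mult_cancel_left) simp
  have xf: "2 * x * f = q\<^sup>2"
    unfolding f power2_eq_square using arg_cong[OF xe, of "\<lambda>u. u * q"] by (simp add: mult_ac)
  have r: "r * p\<^sup>2 = x * (1 + r\<^sup>2)"
  proof -
    have "q = (a - b) * (a + b)"
      unfolding q_def by algebra
    then have rq: "r = q * d\<^sup>2"
      using d unfolding r_def by algebra
    have "1 + r\<^sup>2 = ((a + b)\<^sup>2 + (a - b)\<^sup>2) * d\<^sup>2"
      using d unfolding r_def by algebra
    also have "(a + b)\<^sup>2 + (a - b)\<^sup>2 = 2 * p"
      unfolding p_def by algebra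
    finally have "x * (1 + r\<^sup>2) = r * p\<^sup>2"
      using x unfolding rq by algebra
    then show ?thesis ..
  qed
  then show "4 * r = x * (1 + r\<^sup>2) + 2 * x * f * r"
    unfolding xf using one by algebra
  have "g * p\<^sup>2 = 2 * i * p"
    using ep unfolding g_def by algebra
  moreover have "q * r = (a - b)\<^sup>2"
    using d unfolding r_def q_def by algebra
  then have "2 * x * g * r = 2 * i * (a - b)\<^sup>2"
    using xg by algebra
  moreover have "2 * i * p = 4 + 2 * i * (a - b)\<^sup>2"
    using i unfolding p_def by algebra
  ultimately show "4 * g = 4 + 2 * x * f * g + 2 * x * g * r"
    unfolding xf using one by algebra
qed

text \<open>
  The identities above, divided by four (the last two also multiplied by a common factor \<open>h\<close>), in
  the form of the forward equations: \<open>c\<close> is the weight \<open>1 / 4\<close> of an axis vertex, and \<open>2 * c\<close> is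
  both the weight of a vertex off the axis and the factor \<open>1 / 2\<close> that distinguishes such vertices in the solution.
\<close>

lemma quarter_recursions:
  fixes c f g h r x :: "'a :: idom"
  assumes c: "4 * c = 1"
  shows "4 * g = 4 + 2 * x * f * g + 2 * x * g * r \<Longrightarrow>
      g = 1 + x * (c * (g * r) + c * (g * r) + 2 * c * (2 * c * (g * f)) + 2 * c * (2 * c * (g * f)))"
    and "4 * r = x * (1 + r\<^sup>2) + 2 * x * f * r \<Longrightarrow>
      h * r = x * (c * (h + h * r\<^sup>2) + 2 * c * (2 * c * (h * r * f)) + 2 * c * (2 * c * (h * r * f)))"
    and "2 * f = x * (1 + f\<^sup>2) \<Longrightarrow> 2 * c * (h * f) = x * (c * (h + h * f\<^sup>2))"
proof -
  have cc: "2 * c * (2 * c * u) = c * u" for u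
    using arg_cong[OF c, of "\<lambda>v. v * (c * u)"] by (simp add: mult_ac)
  have c4: "u = c * (4 * u)" for u
    using arg_cong[OF c, of "\<lambda>v. v * u"] by (simp add: mult_ac)
  show "g = 1 + x * (c * (g * r) + c * (g * r) + 2 * c * (2 * c * (g * f)) + 2 * c * (2 * c * (g * f)))"
    if "4 * g = 4 + 2 * x * f * g + 2 * x * g * r"
    unfolding cc by (subst c4, subst that) (use c in \<open>simp add: algebra_simps\<close>)
  show "h * r = x * (c * (h + h * r\<^sup>2) + 2 * c * (2 * c * (h * r * f)) + 2 * c * (2 * c * (h * r * f)))"
    if "4 * r = x * (1 + r\<^sup>2) + 2 * x * f * r"
  proof -
    have "h * r = c * h * (4 * r)" using c4[of "h * r"] by (simp add: mult_ac)
    also have "\<dots> = x * (c * (h + h * r\<^sup>2) + c * (h * r * f) + c * (h * r * f))"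
      unfolding that by (simp add: algebra_simps)
    finally show ?thesis unfolding cc .
  qed
  show "2 * c * (h * f) = x * (c * (h + h * f\<^sup>2))" if "2 * f = x * (1 + f\<^sup>2)"
  proof -
    have "2 * c * (h * f) = c * h * (2 * f)" by (simp add: mult_ac)
    also have "\<dots> = x * (c * (h + h * f\<^sup>2))"
      unfolding that by (simp add: algebra_simps)
    finally show ?thesis .
  qed
qed

lemma inverse_roots_identity:
  fixes a b i j k e :: "'a :: idom"
  assumes "2 * (b ^ 4 * e) = (a\<^sup>2 - b\<^sup>2) * k" "k * (a * b) = 1" and i: "i * a = 1" and j: "j * b = 1"
  shows "2 * e = a * j ^ 5 - i * j ^ 3"
proof -
  have k: "k = i * j"
    using assms by algebra
  have j4: "j ^ 4 * b ^ 4 = 1" "j ^ 3 * b\<^sup>2 * j\<^sup>2 = j ^ 3"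
    using j by algebra+
  have "2 * e = 2 * (b ^ 4 * e) * j ^ 4"
    using arg_cong[OF j4(1), of "\<lambda>v. 2 * e * v"] by (simp add: mult_ac)
  also have "\<dots> = (i * a) * a * j ^ 5 - i * (j ^ 3 * b\<^sup>2 * j\<^sup>2)"
    unfolding assms(1) k by algebra
  finally show ?thesis
    unfolding i j4(2) by simp
qed
section \<open>Powers of 1 - X\<close>

text \<open>
  The formal power series \<open>(1 - X)\<^sup>a\<close>. For \<open>a \<le> 0\<close> its coefficients are nonnegative, which is the
  reason for using it alongside \<open>fps_binomial a\<close>, the series \<open>(1 + X)\<^sup>a\<close>.
\<close>

definition alt_binomial :: "real \<Rightarrow> real fps" where
  "alt_binomial a = fps_binomial a oo (- fps_X)"

lemma alt_binomial_nth: "alt_binomial a $ n = pochhammer (- a) n / fact n"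
proof -
  have "(- 1 :: real) ^ n * (- 1) ^ n = 1"
    by (simp flip: power_mult_distrib)
  then show ?thesis
    by (simp add: alt_binomial_def fps_compose_uminus' gbinomial_pochhammer flip: mult.assoc)
qed

lemma alt_binomial_add: "alt_binomial (a + b) = alt_binomial a * alt_binomial b"
  by (simp add: alt_binomial_def fps_binomial_add_mult fps_compose_mult_distrib)

lemma alt_binomial_0 [simp]: "alt_binomial 0 = 1"
  by (simp add: alt_binomial_def)

lemma alt_binomial_1: "alt_binomial 1 = 1 - fps_X"
  by (simp add: alt_binomial_def fps_binomial_1 fps_compose_add_distrib)

lemma alt_binomial_minus_1_nth: "alt_binomial (- 1) $ n = 1"
  by (simp add: alt_binomial_nth flip: pochhammer_fact)

lemma alt_binomial_nonneg: "a \<le> 0 \<Longrightarrow> 0 \<le> alt_binomial a $ n"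
  by (cases "a = 0") (auto simp: alt_binomial_nth intro!: divide_nonneg_nonneg less_imp_le[OF pochhammer_pos])

lemma abs_gbinomial_nonpos:
  assumes "a \<le> (0::real)"
  shows "\<bar>a gchoose n\<bar> = alt_binomial a $ n"
proof -
  have "\<bar>a gchoose n\<bar> = \<bar>alt_binomial a $ n\<bar>"
    by (simp add: alt_binomial_nth gbinomial_pochhammer abs_mult power_abs)
  then show ?thesis using alt_binomial_nonneg[OF assms, of n] by simp
qed

text \<open>
  From index one on the coefficients of \<open>(1 - X)\<^sup>a\<close> are nonpositive, so absolute summability amounts to
  a lower bound on their partial sums. These are the coefficients of \<open>(1 - X)\<^sup>a\<^sup>-\<^sup>1\<close>, which are
  nonnegative.
\<close>

lemma summable_abs_gbinomial:
  fixes a :: real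
  assumes "0 < a" "a < 1"
  shows "summable (\<lambda>n. \<bar>a gchoose n\<bar>)"
proof -
  have tail: "\<bar>a gchoose Suc n\<bar> = - alt_binomial a $ Suc n" for n
  proof -
    have "pochhammer (- a) (Suc n) \<le> 0"
      using assms pochhammer_pos[of "1 - a" n]
      by (simp add: pochhammer_rec mult_nonneg_nonneg)
    then have "alt_binomial a $ Suc n \<le> 0"
      by (simp add: alt_binomial_nth divide_nonpos_pos)
    moreover have "\<bar>a gchoose Suc n\<bar> = \<bar>alt_binomial a $ Suc n\<bar>"
      by (simp add: alt_binomial_nth gbinomial_pochhammer abs_mult power_abs)
    ultimately show ?thesis by simp
  qed
  have "(\<Sum>k\<le>n. \<bar>a gchoose Suc k\<bar>) \<le> 1" for n
  proof -
    have "(\<Sum>k\<le>Suc n. alt_binomial a $ k) = (alt_binomial a * alt_binomial (- 1)) $ Suc n"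
      by (simp add: fps_mult_nth alt_binomial_minus_1_nth atLeast0AtMost del: sum.atMost_Suc)
    also have "\<dots> = alt_binomial (a - 1) $ Suc n"
      by (simp flip: alt_binomial_add)
    also have "\<dots> \<ge> 0"
      using assms by (intro alt_binomial_nonneg) simp
    finally have "(\<Sum>k\<le>Suc n. alt_binomial a $ k) \<ge> 0" .
    then show ?thesis
      unfolding sum.atMost_Suc_shift by (simp add: tail sum_negf alt_binomial_nth)
  qed
  then have "summable (\<lambda>n. \<bar>a gchoose Suc n\<bar>)"
    by (intro bounded_imp_summable) auto
  then show ?thesis by (rule summable_Suc_iff[THEN iffD1])
qed

section \<open>Asymptotics of binomial convolutions\<close>

text \<open>
  Abel's limit of the binomial series at the endpoint of its disc of convergence; the interchange of
  limit and sum is Tannery's theorem with the summable bound just found.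
\<close>

lemma suminf_gbinomial:
  fixes a :: real
  assumes "0 < a" "a < 1"
  shows "(\<Sum>n. a gchoose n) = 2 powr a"
proof -
  have "((\<lambda>x. \<Sum>n. (a gchoose n) * x ^ n) \<longlongrightarrow> (\<Sum>n. (a gchoose n))) (at_left 1)"
  proof (rule tannerys_theorem[THEN conjunct2, THEN conjunct2])
    show "((\<lambda>x. (a gchoose k) * x ^ k) \<longlongrightarrow> (a gchoose k)) (at_left 1)" for k
      by (auto intro!: tendsto_eq_intros)
    have "eventually (\<lambda>x::real. 0 < x \<and> x < 1) (at_left 1)"
      unfolding eventually_at_left_field by (intro exI[of _ 0]) auto
    then have "\<forall>\<^sub>F (k, x) in (at_top :: nat filter) \<times>\<^sub>F at_left (1::real). 0 < x \<and> x < 1"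
      by (rule eventually_prod2[THEN iffD2, rotated]) simp
    then show "\<forall>\<^sub>F (k, x) in (at_top :: nat filter) \<times>\<^sub>F at_left (1::real).
        norm ((a gchoose k) * x ^ k) \<le> \<bar>a gchoose k\<bar>"
      by eventually_elim (auto simp: abs_mult power_abs intro!: mult_left_le power_le_one)
  qed (use summable_abs_gbinomial[OF assms] in auto)
  moreover have "((\<lambda>x. \<Sum>n. (a gchoose n) * x ^ n) \<longlongrightarrow> 2 powr a) (at_left 1)"
  proof (rule Lim_transform_eventually)
    show "((\<lambda>x. (1 + x) powr a) \<longlongrightarrow> 2 powr a) (at_left 1)"
      by (auto intro!: tendsto_eq_intros)
    have "eventually (\<lambda>x::real. 0 < x \<and> x < 1) (at_left 1)"
      unfolding eventually_at_left_field by (intro exI[of _ 0]) auto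
    then show "\<forall>\<^sub>F x in at_left 1. (1 + x) powr a = (\<Sum>n. (a gchoose n) * x ^ n)"
      by eventually_elim (rule sums_unique, rule gen_binomial_real, auto)
  qed
  ultimately show ?thesis
    by (rule tendsto_unique[rotated]) simp
qed

text \<open>
  Each fixed shift \<open>k\<close> leaves the growth of \<open>d\<close> unchanged, and monotonicity of \<open>d\<close> gives a bound
  that is uniform in the shift, so Tannery's theorem applies.
\<close>

lemma convolution_asymptotic:
  fixes e d :: "nat \<Rightarrow> real"
  assumes e: "summable (\<lambda>k. \<bar>e k\<bar>)"
    and d: "incseq d" "\<And>n. 0 \<le> d n"
    and lim: "(\<lambda>n. d n / real n powr s) \<longlonglongrightarrow> L"
  shows "(\<lambda>n. (\<Sum>k\<le>n. e k * d (n - k)) / real n powr s) \<longlonglongrightarrow> (\<Sum>k. e k) * L"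
proof -
  obtain K where K: "\<And>n. \<bar>d n / real n powr s\<bar> \<le> K"
    using convergent_imp_Bseq[OF convergentI[OF lim]] by (auto simp: Bseq_def)
  define a where "a k n = (if k \<le> n then e k * d (n - k) / real n powr s else 0)" for k n
  have "(\<lambda>n. \<Sum>k. a k n) \<longlonglongrightarrow> (\<Sum>k. e k * L)"
  proof (rule tannerys_theorem[THEN conjunct2, THEN conjunct2])
    show "(\<lambda>n. a k n) \<longlonglongrightarrow> e k * L" for k
    proof (rule LIMSEQ_offset[where k = k])
      have "(\<lambda>n. 1 - real k * inverse (real (n + k))) \<longlonglongrightarrow> 1 - real k * 0"
        by (intro tendsto_intros LIMSEQ_ignore_initial_segment[OF lim_inverse_n])
      moreover have "\<forall>\<^sub>F n in sequentially. 1 - real k * inverse (real (n + k)) = real n / real (n + k)"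
        using eventually_gt_at_top[of 0] by eventually_elim (simp add: field_simps)
      ultimately have "(\<lambda>n. real n / real (n + k)) \<longlonglongrightarrow> 1 - real k * 0"
        by (rule Lim_transform_eventually)
      then have "(\<lambda>n. real n / real (n + k)) \<longlonglongrightarrow> 1" by simp
      then have "(\<lambda>n. (real n / real (n + k)) powr s) \<longlonglongrightarrow> 1"
        using tendsto_powr[OF _ tendsto_const, of "\<lambda>n. real n / real (n + k)" 1 sequentially s] by simp
      from tendsto_mult[OF tendsto_mult[OF tendsto_const[of "e k"] lim] this]
      have "(\<lambda>n. e k * (d n / real n powr s) * (real n / real (n + k)) powr s) \<longlonglongrightarrow> e k * L" by simp
      then show "(\<lambda>n. a k (n + k)) \<longlonglongrightarrow> e k * L"
      proof (rule Lim_transform_eventually)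
        show "\<forall>\<^sub>F n in sequentially.
            e k * (d n / real n powr s) * (real n / real (n + k)) powr s = a k (n + k)"
          using eventually_gt_at_top[of 0] by eventually_elim (simp add: a_def powr_divide)
      qed
    qed
    have "norm (a k n) \<le> \<bar>e k\<bar> * K" for k n
    proof (cases "k \<le> n")
      case True
      have "d (n - k) / real n powr s \<le> d n / real n powr s"
        using d(1) by (intro divide_right_mono) (auto simp: incseq_def)
      with K[of n] d(2) have "\<bar>d (n - k) / real n powr s\<bar> \<le> K" by simp
      from mult_left_mono[OF this abs_ge_zero[of "e k"]] True show ?thesis
        by (simp add: a_def abs_mult)
    next
      case False
      moreover have "0 \<le> K" using K[of 0] by linarith
      ultimately show ?thesis by (simp add: a_def)
    qed
    then show "\<forall>\<^sub>F (k, n) in at_top \<times>\<^sub>F sequentially. norm (a k n) \<le> \<bar>e k\<bar> * K"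
      by (intro always_eventually) auto
    show "summable (\<lambda>k. \<bar>e k\<bar> * K)" using e by (rule summable_mult2)
  qed simp
  moreover have "(\<Sum>k. a k n) = (\<Sum>k\<le>n. e k * d (n - k)) / real n powr s" for n
    by (subst suminf_finite[of "{..n}"]) (auto simp: a_def sum_divide_distrib)
  moreover have "(\<Sum>k. e k * L) = (\<Sum>k. e k) * L"
    by (rule suminf_mult2[OF summable_rabs_cancel[OF e], symmetric])
  ultimately show ?thesis by simp
qed

lemma incseq_alt_binomial:
  assumes "a \<le> - 1"
  shows "incseq (\<lambda>n. alt_binomial a $ n)"
proof (rule incseq_SucI)
  fix n
  have "alt_binomial a $ Suc n = ((real n - a) / (1 + real n)) * alt_binomial a $ n"
    by (simp add: alt_binomial_nth pochhammer_Suc field_simps)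
  moreover have "1 * alt_binomial a $ n \<le> ((real n - a) / (1 + real n)) * alt_binomial a $ n"
    using assms by (intro mult_right_mono alt_binomial_nonneg) auto
  ultimately show "alt_binomial a $ n \<le> alt_binomial a $ Suc n" by simp
qed

lemma alt_binomial_asymptotic:
  "(\<lambda>n. alt_binomial a $ n / real n powr (- a - 1)) \<longlonglongrightarrow> 1 / Gamma (- a)"
proof -
  have "(\<lambda>n. (a gchoose n) / ((- 1) ^ n / exp ((a + 1) * ln (real n)))) \<longlonglongrightarrow> 1 / Gamma (- a)"
    using gbinomial_asymptotic[of a] by (simp add: inverse_eq_divide)
  then show ?thesis
  proof (rule Lim_transform_eventually)
    show "\<forall>\<^sub>F n in sequentially. (a gchoose n) / ((- 1) ^ n / exp ((a + 1) * ln (real n))) =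
        alt_binomial a $ n / real n powr (- a - 1)"
      using eventually_gt_at_top[of 0]
    proof eventually_elim
      fix n :: nat assume "0 < n"
      have "real n powr (- a - 1) = 1 / exp ((a + 1) * ln (real n))"
        using \<open>0 < n\<close> powr_minus[of "real n" "a + 1"]
        by (simp add: powr_def inverse_eq_divide flip: exp_minus)
      moreover have "(a gchoose n) / (- 1) ^ n = alt_binomial a $ n"
        by (simp add: alt_binomial_nth gbinomial_pochhammer)
      then have "(a gchoose n) / ((- 1) ^ n / x) = alt_binomial a $ n * x" for x
        by (simp flip: \<open>_ = alt_binomial a $ n\<close>)
      ultimately show "(a gchoose n) / ((- 1) ^ n / exp ((a + 1) * ln (real n))) =
        alt_binomial a $ n / real n powr (- a - 1)" by simp
    qed
  qed
qed

lemma binomial_convolution_asymptotic: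
  fixes a b :: real
  assumes "0 < a" "a < 1" "b \<le> - 1"
  shows "(\<lambda>n. (fps_binomial a * alt_binomial b) $ n / real n powr (- b - 1))
    \<longlonglongrightarrow> 2 powr a / Gamma (- b)"
  using convolution_asymptotic[OF summable_abs_gbinomial[OF assms(1,2)] incseq_alt_binomial[OF assms(3)]
      alt_binomial_nonneg alt_binomial_asymptotic[of b]] assms
  by (simp add: suminf_gbinomial fps_mult_nth atLeast0AtMost)

text \<open>
  Taking absolute values of the coefficients turns \<open>(1 + X)\<^sup>-\<^sup>a\<close> into \<open>(1 - X)\<^sup>-\<^sup>a\<close>, and the product
  becomes \<open>(1 - X)\<^sup>-\<^sup>1\<close>, all of whose coefficients are one.
\<close>

lemma binomial_convolution_bound:
  assumes "0 \<le> a" "a \<le> (1 :: real)"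
  shows "\<bar>(fps_binomial (- a) * alt_binomial (a - 1)) $ n\<bar> \<le> 1"
proof -
  have "\<bar>(fps_binomial (- a) * alt_binomial (a - 1)) $ n\<bar>
      \<le> (\<Sum>k=0..n. \<bar>(- a gchoose k) * alt_binomial (a - 1) $ (n - k)\<bar>)"
    unfolding fps_mult_nth fps_binomial_nth by (rule sum_abs)
  also have "\<dots> = (alt_binomial (- a) * alt_binomial (a - 1)) $ n"
    using assms by (simp add: fps_mult_nth abs_mult abs_gbinomial_nonpos alt_binomial_nonneg)
  also have "\<dots> = 1"
    by (simp add: alt_binomial_minus_1_nth flip: alt_binomial_add)
  finally show ?thesis .
qed

section \<open>Generating functions of the walk on the comb\<close>

definition plus_root :: "real fps" where "plus_root = fps_binomial (1 / 4)"
definition minus_root :: "real fps" where "minus_root = alt_binomial (1 / 4)"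

text \<open>
  The Green function of the walk at the origin, and the factors by which it decays with each step away
  from the origin along the axis and, off the axis, with each step along a tooth. The last one is
  \<open>(1 - sqrt (1 - X\<^sup>2)) / X\<close>, the generating function of the first passage time of the simple random
  walk on the integers from \<open>1\<close> to \<open>0\<close>.
\<close>

definition comb_origin :: "real fps" where
  "comb_origin = 2 * inverse (plus_root * minus_root * (plus_root\<^sup>2 + minus_root\<^sup>2))"
definition comb_horizontal :: "real fps" where
  "comb_horizontal = (plus_root - minus_root) * inverse (plus_root + minus_root)"
definition comb_vertical :: "real fps" where
  "comb_vertical = (plus_root\<^sup>2 - minus_root\<^sup>2) * inverse (plus_root\<^sup>2 + minus_root\<^sup>2)"

lemma plus_root_nth_0: "plus_root $ 0 = 1" by (simp add: plus_root_def)
lemma minus_root_nth_0: "minus_root $ 0 = 1" by (simp add: minus_root_def alt_binomial_nth)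

lemma plus_root_power_4: "plus_root ^ 4 = 1 + fps_X"
  using fps_binomial_power[of "1 / 4 :: real" 4] by (simp add: plus_root_def fps_binomial_1)

lemma minus_root_power_4: "minus_root ^ 4 = 1 - fps_X"
proof -
  have "minus_root ^ 4 = alt_binomial (1 / 4 + 1 / 4 + (1 / 4 + 1 / 4))"
    unfolding alt_binomial_add minus_root_def by (simp add: power4_eq_xxxx mult.assoc)
  then show ?thesis by (simp add: alt_binomial_1)
qed

lemma unit_identities:
  shows "inverse (plus_root + minus_root) * (plus_root + minus_root) = 1"
    and "inverse (plus_root\<^sup>2 + minus_root\<^sup>2) * (plus_root\<^sup>2 + minus_root\<^sup>2) = 1"
    and "inverse (plus_root * minus_root) * (plus_root * minus_root) = 1"
  by (rule inverse_mult_eq_1; simp add: plus_root_nth_0 minus_root_nth_0 power2_eq_square)+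

lemma two_neq_0_fps: "(2 :: real fps) \<noteq> 0"
  by (simp add: numeral_fps_const)

lemma comb_origin_altdef: "comb_origin = 2 * (inverse (plus_root * minus_root) * inverse (plus_root\<^sup>2 + minus_root\<^sup>2))"
  by (simp add: comb_origin_def fps_inverse_mult)

lemmas comb_identities =
  fourth_roots_ring_identities[OF plus_root_power_4 minus_root_power_4 unit_identities two_neq_0_fps,
    folded comb_horizontal_def comb_vertical_def comb_origin_altdef]

text \<open>
  The generating function of the probabilities of being at a given vertex. The factor \<open>1 / 2\<close> off the
  axis is the ratio of the degrees of vertices off and on the axis.
\<close>

definition comb_green :: "int \<times> int \<Rightarrow> real fps" where
  "comb_green = (\<lambda>(x, y). fps_const (if y = 0 then 1 else 1 / 2) *
    (comb_origin * comb_horizontal ^ nat \<bar>x\<bar> * comb_vertical ^ nat \<bar>y\<bar>))"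

text \<open>
  Forward equation. On the axis, the origin and the other vertices are governed by the equations for
  \<open>comb_origin\<close> and \<open>comb_horizontal\<close>; off the axis the equation for \<open>comb_vertical\<close> suffices, and
  this includes the vertices next to the axis: the weight \<open>1 / 4\<close> of an axis vertex equals the weight
  \<open>1 / 2\<close> times the factor \<open>1 / 2\<close> of the vertices off the axis.
\<close>

lemma comb_green_eq:
  "comb_green w = (if w = (0, 0) then 1 else 0) +
    fps_X * (\<Sum>v | comb_adj w v. fps_const (if snd v = 0 then 1 / 4 else 1 / 2) * comb_green v)"
proof -
  define c where "c = fps_const (1 / 4 :: real)"
  have c: "4 * c = 1" "fps_const (1 / 2) = 2 * c"
    by (simp_all add: c_def numeral_fps_const)
  let ?G = comb_origin and ?r = comb_horizontal and ?f = comb_vertical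
  note rec = quarter_recursions[OF c(1)]
  obtain x y where w: "w = (x, y)" by (cases w)
  show ?thesis
  proof (cases "y = 0")
    case True
    have sum: "(\<Sum>v | comb_adj w v. fps_const (if snd v = 0 then 1 / 4 else 1 / 2) * comb_green v)
        = c * comb_green (x + 1, 0) + c * comb_green (x - 1, 0)
          + 2 * c * comb_green (x, 1) + 2 * c * comb_green (x, - 1)"
      unfolding w True comb_neighbours_axis by (simp add: add_ac c(2) flip: c_def)
    have vert: "comb_green (x, 1) = 2 * c * (?G * ?r ^ nat \<bar>x\<bar> * ?f)"
       "comb_green (x, - 1) = 2 * c * (?G * ?r ^ nat \<bar>x\<bar> * ?f)"
      by (simp_all add: comb_green_def c(2))
    have hor: "comb_green (z, 0) = ?G * ?r ^ nat \<bar>z\<bar>" for z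
      by (simp add: comb_green_def)
    show ?thesis
    proof (cases "x = 0")
      case x: True
      have "?G = 1 + fps_X * (c * (?G * ?r) + c * (?G * ?r) + 2 * c * (2 * c * (?G * ?f)) + 2 * c * (2 * c * (?G * ?f)))"
        by (rule rec(1)[OF comb_identities(3)])
      then show ?thesis
        unfolding sum vert hor unfolding w True hor x by simp
    next
      case x: False
      define k where "k = nat \<bar>x\<bar> - 1"
      have k: "nat \<bar>x\<bar> = Suc k" using x by (simp add: k_def)
      have nb: "comb_green (x + 1, 0) + comb_green (x - 1, 0) = ?G * ?r ^ k + ?G * ?r ^ (k + 2)"
      proof (cases "x > 0")
        case True
        then have "nat \<bar>x + 1\<bar> = k + 2" "nat \<bar>x - 1\<bar> = k" by (auto simp: k_def)
        then show ?thesis by (simp only: hor add.commute)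
      next
        case False
        then have "nat \<bar>x + 1\<bar> = k" "nat \<bar>x - 1\<bar> = k + 2" using x by (auto simp: k_def)
        then show ?thesis by (simp only: hor add.commute)
      qed
      have "?G * ?r ^ k * ?r = fps_X * (c * (?G * ?r ^ k + ?G * ?r ^ k * ?r\<^sup>2)
          + 2 * c * (2 * c * (?G * ?r ^ k * ?r * ?f)) + 2 * c * (2 * c * (?G * ?r ^ k * ?r * ?f)))"
        by (rule rec(2)[OF comb_identities(2)])
      then have "?G * ?r ^ Suc k = fps_X * (c * (?G * ?r ^ k + ?G * ?r ^ (k + 2))
          + 2 * c * (2 * c * (?G * ?r ^ Suc k * ?f)) + 2 * c * (2 * c * (?G * ?r ^ Suc k * ?f)))"
        unfolding power_add power_Suc2 mult.assoc .
      then have "comb_green (x, 0) = fps_X * (c * comb_green (x + 1, 0) + c * comb_green (x - 1, 0)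
          + 2 * c * comb_green (x, 1) + 2 * c * comb_green (x, - 1))"
        unfolding vert hor[of x] k nb[symmetric] distrib_left[of c] .
      then show ?thesis
        unfolding sum unfolding w True using x by simp
    qed
  next
    case False
    define k where "k = nat \<bar>y\<bar> - 1"
    have k: "nat \<bar>y\<bar> = Suc k" using False by (simp add: k_def)
    let ?H = "?G * ?r ^ nat \<bar>x\<bar>"
    have weighted: "fps_const (if snd v = 0 then 1 / 4 else 1 / 2) * comb_green v =
        c * (?G * ?r ^ nat \<bar>fst v\<bar> * ?f ^ nat \<bar>snd v\<bar>)" for v
      by (cases v) (auto simp: comb_green_def c_def simp flip: mult.assoc fps_const_mult)
    have nb: "?H * ?f ^ nat \<bar>y + 1\<bar> + ?H * ?f ^ nat \<bar>y - 1\<bar> = ?H * ?f ^ k + ?H * ?f ^ (k + 2)"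
    proof (cases "y > 0")
      case True
      then have "nat \<bar>y + 1\<bar> = k + 2" "nat \<bar>y - 1\<bar> = k" by (auto simp: k_def)
      then show ?thesis by (simp only: add.commute)
    next
      case n: False
      then have "nat \<bar>y + 1\<bar> = k" "nat \<bar>y - 1\<bar> = k + 2" using False by (auto simp: k_def)
      then show ?thesis by (simp only: add.commute)
    qed
    have "comb_green w = 2 * c * (?H * ?f ^ k * ?f)"
      using False by (simp add: w comb_green_def c(2) k mult_ac)
    also have "\<dots> = fps_X * (c * (?H * ?f ^ k + ?H * ?f ^ k * ?f\<^sup>2))"
      by (rule rec(3)[OF comb_identities(1)])
    also have "\<dots> = fps_X * (c * (?H * ?f ^ k + ?H * ?f ^ (k + 2)))"
      by (simp only: power_add mult.assoc)
    also have "\<dots> = fps_X * (\<Sum>v | comb_adj w v. fps_const (if snd v = 0 then 1 / 4 else 1 / 2) * comb_green v)"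
      unfolding weighted nb[symmetric] w comb_neighbours_off_axis[OF False]
      by (simp add: distrib_left)
    finally show ?thesis using False by (simp add: w)
  qed
qed

text \<open>
  The forward equation determines each coefficient from the preceding ones, so its solution is unique.
\<close>

lemma comb_green_nth: "comb_green v $ n = pmf (comb_law n) v"
proof (induction n arbitrary: v)
  case 0
  show ?case by (subst comb_green_eq) (simp add: indicator_def)
next
  case (Suc n)
  have "comb_green v $ Suc n
      = (\<Sum>u | comb_adj v u. (if snd u = 0 then 1 / 4 else 1 / 2) * comb_green u $ n)"
    by (subst comb_green_eq) (simp add: fps_sum_nth)
  then show ?case
    unfolding comb_law_forward Suc by (simp add: mult.commute)
qed

section \<open>The expected horizontal displacement\<close>

text \<open>
  Summing the increments, the expected displacement has the generating function
  \<open>X * comb_origin / (2 * (1 - X))\<close>. As \<open>1 - X\<close> is the fourth power of \<open>minus_root\<close>, this is half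
  the difference of \<open>(1 + X)\<^sup>1\<^sup>/\<^sup>4 * (1 - X)\<^sup>-\<^sup>5\<^sup>/\<^sup>4\<close> and \<open>(1 + X)\<^sup>-\<^sup>1\<^sup>/\<^sup>4 * (1 - X)\<^sup>-\<^sup>3\<^sup>/\<^sup>4\<close>.
\<close>

lemma expectation_comb_explicit:
  "2 * measure_pmf.expectation (comb_law n) (\<lambda>u. \<bar>real_of_int (fst u)\<bar>)
    = (fps_binomial (1 / 4) * alt_binomial (- (5 / 4))) $ n
      - (fps_binomial (- (1 / 4)) * alt_binomial (- (3 / 4))) $ n"
proof -
  define E where "E = Abs_fps (\<lambda>n. measure_pmf.expectation (comb_law n) (\<lambda>u. \<bar>real_of_int (fst u)\<bar>))"
  have "2 * ((1 - fps_X) * E) = fps_X * comb_origin"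
  proof (rule fps_ext)
    fix n
    have "comb_origin $ m = pmf (comb_law m) (0, 0)" for m
      using comb_green_nth[of "(0, 0)" m] by (simp add: comb_green_def)
    then show "(2 * ((1 - fps_X) * E)) $ n = (fps_X * comb_origin) $ n"
      by (cases n) (simp_all add: E_def left_diff_distrib expectation_comb_Suc
          numeral_fps_const del: walk_law.simps(2))
  qed
  then have E: "2 * (minus_root ^ 4 * E) = (plus_root\<^sup>2 - minus_root\<^sup>2) * inverse (plus_root * minus_root)"
    by (simp add: minus_root_power_4 comb_identities)
  define ia where "ia = fps_binomial (- (1 / 4) :: real)"
  define ib where "ib = alt_binomial (- (1 / 4))"
  have ia: "ia * plus_root = 1" and ib: "ib * minus_root = 1"
    by (simp_all add: ia_def plus_root_def ib_def minus_root_def flip: fps_binomial_add_mult alt_binomial_add)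
  have "2 * E = plus_root * ib ^ 5 - ia * ib ^ 3"
    by (rule inverse_roots_identity[OF E unit_identities(3) ia ib])
  moreover have "ib ^ 3 = alt_binomial (- (1 / 4) + (- (1 / 4) + - (1 / 4)))"
    unfolding alt_binomial_add by (simp add: ib_def power3_eq_cube)
  moreover have "ib ^ 5 = alt_binomial (- (1 / 4) + (- (1 / 4) + (- (1 / 4) + (- (1 / 4) + - (1 / 4)))))"
    unfolding alt_binomial_add by (simp add: ib_def eval_nat_numeral)
  ultimately have "2 * E = fps_binomial (1 / 4) * alt_binomial (- (5 / 4))
      - fps_binomial (- (1 / 4)) * alt_binomial (- (3 / 4))"
    by (simp add: ia_def plus_root_def)
  then have "(2 * E) $ n = (fps_binomial (1 / 4) * alt_binomial (- (5 / 4))) $ n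
      - (fps_binomial (- (1 / 4)) * alt_binomial (- (3 / 4))) $ n"
    by simp
  then show ?thesis by (simp add: E_def numeral_fps_const)
qed

theorem theorem3p1:
  fixes M :: "'w measure" and S :: "nat \<Rightarrow> 'w \<Rightarrow> int \<times> int"
  assumes "simple_random_walk M comb_adj (0, 0) S"
  shows "(\<lambda>n. integral\<^sup>L M (\<lambda>\<omega>. \<bar>real_of_int (fst (S n \<omega>))\<bar>))
    \<sim>[at_top] (\<lambda>n. 1 / (2 powr (3 / 4) * Gamma (5 / 4)) * real n powr (1 / 4))"
proof -
  interpret simple_random_walk M comb_adj "(0, 0)" S by fact
  let ?E = "\<lambda>n. integral\<^sup>L M (\<lambda>\<omega>. \<bar>real_of_int (fst (S n \<omega>))\<bar>)"
  define u where "u n = (fps_binomial (1 / 4) * alt_binomial (- (5 / 4))) $ n" for n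
  define v where "v n = (fps_binomial (- (1 / 4)) * alt_binomial (- (3 / 4))) $ n" for n
  have E: "?E n = u n / 2 - v n / 2" for n
  proof -
    have "?E n = integral\<^sup>L (distr M (count_space UNIV) (S n)) (\<lambda>u. \<bar>real_of_int (fst u)\<bar>)"
      using random_variable by (subst integral_distr) auto
    also have "\<dots> = measure_pmf.expectation (comb_law n) (\<lambda>u. \<bar>real_of_int (fst u)\<bar>)"
      by (simp add: distr_walk[OF assms])
    finally show ?thesis
      using expectation_comb_explicit[of n] by (simp add: u_def v_def)
  qed
  have u: "(\<lambda>n. u n / real n powr (1 / 4)) \<longlonglongrightarrow> 2 powr (1 / 4) / Gamma (5 / 4)"
    using binomial_convolution_asymptotic[of "1 / 4" "- (5 / 4)"] by (simp add: u_def)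
  have v: "(\<lambda>n. v n / real n powr (1 / 4)) \<longlonglongrightarrow> 0"
  proof (rule Lim_null_comparison)
    show "\<forall>\<^sub>F n in sequentially. norm (v n / real n powr (1 / 4)) \<le> real n powr - (1 / 4)"
    proof (intro always_eventually allI)
      fix n
      have "\<bar>v n\<bar> \<le> 1"
        using binomial_convolution_bound[of "1 / 4" n] by (simp add: v_def)
      then show "norm (v n / real n powr (1 / 4)) \<le> real n powr - (1 / 4)"
        by (simp add: powr_minus abs_divide inverse_eq_divide divide_right_mono)
    qed
    show "(\<lambda>n. real n powr - (1 / 4)) \<longlonglongrightarrow> 0"
      by (rule tendsto_neg_powr[OF _ filterlim_real_sequentially]) simp
  qed
  have "(\<lambda>n. (u n / real n powr (1 / 4)) / 2 - (v n / real n powr (1 / 4)) / 2)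
      \<longlonglongrightarrow> 2 powr (1 / 4) / Gamma (5 / 4) / 2 - 0 / 2"
    by (intro tendsto_diff tendsto_divide[OF u] tendsto_divide[OF v] tendsto_const) auto
  moreover have "2 powr (1 / 4) / Gamma (5 / 4) / 2 - 0 / 2 = 1 / (2 powr (3 / 4) * Gamma (5 / 4 :: real))"
  proof -
    have two: "2 powr (1 / 4) * 2 powr (3 / 4) = (2 :: real)"
      by (simp flip: powr_add)
    have cancel: "p / g / 2 - 0 / 2 = 1 / (q * g)" if "p * q = 2" for p q g :: real
    proof -
      have "q \<noteq> 0" using that by auto
      then have "p = 2 / q" using that by (simp add: eq_divide_eq)
      then show ?thesis by simp
    qed
    show ?thesis by (rule cancel[OF two])
  qed
  moreover have "u n / real n powr (1 / 4) / 2 - v n / real n powr (1 / 4) / 2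
      = ?E n / real n powr (1 / 4)" for n
    unfolding E diff_divide_distrib by (simp only: divide_divide_eq_left mult.commute)
  ultimately have lim: "(\<lambda>n. ?E n / real n powr (1 / 4)) \<longlonglongrightarrow> 1 / (2 powr (3 / 4) * Gamma (5 / 4))"
    by simp
  have "0 < Gamma (5 / 4 :: real)" by (rule Gamma_real_pos) simp
  show ?thesis
  proof (rule asymp_equivI')
    have "(\<lambda>n. ?E n / real n powr (1 / 4) / (1 / (2 powr (3 / 4) * Gamma (5 / 4)))) \<longlonglongrightarrow> 1"
      using tendsto_divide[OF lim tendsto_const, of "1 / (2 powr (3 / 4) * Gamma (5 / 4))"]
        \<open>0 < Gamma (5 / 4 :: real)\<close> by simp
    then show "(\<lambda>n. ?E n / (1 / (2 powr (3 / 4) * Gamma (5 / 4)) * real n powr (1 / 4))) \<longlonglongrightarrow> 1"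
      by (simp add: mult_ac)
  qed
qed

end
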